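(* Let $k\ge s\ge1$ and let $0=t_0<t_1<\dots<t_k=1$ be abscissae that are symmetrically distributed, i.e. $t_{k-i}=1-t_i$ for $i=0,\dots,k$. Then the $(k+1)$-stage Runge-Kutta method with abscissae $t_0,\dots,t_k$, weights $b_0,\dots,b_k$ and coefficient matrix $C=\bar{\mathcal I}D_s\bar{\mathcal P}^T\bar\Omega$ (the Runge-Kutta form of the HBVM$(k,s)$ block method) is symmetric, that is, it is self-adjoint.
   Context: $P_n$ ($n\ge0$) are the shifted Legendre polynomials on $[0,1]$: $\deg P_n=n$, $\int_0^1P_nP_l\,dx=\frac{1}{2n+1}\delta_{nl}$, $P_n(1)=1$. The weights are the interpolatory ones, $b_i=\int_0^1\prod_{j=0,\,j\ne i}^k\frac{t-t_j}{t_i-t_j}\,dt$. Moreover $D_s=\mathrm{diag}(1,3,\dots,2s-1)\in\mathbb{R}^{s\times s}$, $\bar\Omega=\mathrm{diag}(b_0,\dots,b_k)$, and $$\bar{\mathcal P}=\begin{pmatrix}P_0(t_0)&\dots&P_{s-1}(t_0)\\ \vdots&&\vdots\\P_0(t_k)&\dots&P_{s-1}(t_k)\end{pmatrix},\qquad \bar{\mathcal I}=\begin{pmatrix}\int_0^{t_0}P_0(x)dx&\dots&\int_0^{t_0}P_{s-1}(x)dx\\ \vdots&&\vdots\\ \int_0^{t_k}P_0(x)dx&\dots&\int_0^{t_k}P_{s-1}(x)dx\end{pmatrix}$$ are in $\mathbb{R}^{(k+1)\times s}$. Applied to $y'=f(y)$ (with $f=J\nabla H$, $J=\begin{pmatrix}0&I_m\\-I_m&0\end{pmatrix}$)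 from $y_0$ with stepsize $h$, the method has stages $Y_i=y_0+h\sum_{j=0}^kC_{ij}f(Y_j)$, $i=0,\dots,k$ (rows and columns of $C$ indexed from $0$ to $k$), and the new approximation is $y_0+h\sum_jb_jf(Y_j)$. A one-step method with map $\Phi_h$ is symmetric (self-adjoint) if it coincides with its adjoint, i.e. $\Phi_h=\Phi_{-h}^{-1}$. *)

theory Defs
  imports
    "HOL-Analysis.Analysis"
    "HOL-Computational_Algebra.Polynomial"
    "Jordan_Normal_Form.Matrix"
begin

text \<open>
  These three conditions determine the family uniquely.
\<close>

definition shifted_legendre :: "(nat \<Rightarrow> real poly) \<Rightarrow> bool" where
  "shifted_legendre P \<longleftrightarrow>
     (\<forall>n. degree (P n) = n) \<and>
     (\<forall>n l. integral {0..1} (\<lambda>x. poly (P n) x * poly (P l) x)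
              = (if n = l then 1 / (2 * real n + 1) else 0)) \<and>
     (\<forall>n. poly (P n) 1 = 1)"

definition interp_weight :: "nat \<Rightarrow> (nat \<Rightarrow> real) \<Rightarrow> nat \<Rightarrow> real" where
  "interp_weight k t i =
     integral {0..1} (\<lambda>x. \<Prod>j\<in>{0..k} - {i}. (x - t j) / (t i - t j))"

definition P_mat :: "(nat \<Rightarrow> real poly) \<Rightarrow> nat \<Rightarrow> nat \<Rightarrow> (nat \<Rightarrow> real) \<Rightarrow> real mat" where
  "P_mat P k s t = Matrix.mat (k + 1) s (\<lambda>(i, l). poly (P l) (t i))"

definition I_mat :: "(nat \<Rightarrow> real poly) \<Rightarrow> nat \<Rightarrow> nat \<Rightarrow> (nat \<Rightarrow> real) \<Rightarrow> real mat" where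
  "I_mat P k s t = Matrix.mat (k + 1) s (\<lambda>(i, l). integral {0..t i} (poly (P l)))"

definition D_mat :: "nat \<Rightarrow> real mat" where
  "D_mat s = mat_diag s (\<lambda>l. 2 * real l + 1)"

definition Omega_mat :: "nat \<Rightarrow> (nat \<Rightarrow> real) \<Rightarrow> real mat" where
  "Omega_mat k t = mat_diag (k + 1) (interp_weight k t)"

definition hbvm_mat :: "(nat \<Rightarrow> real poly) \<Rightarrow> nat \<Rightarrow> nat \<Rightarrow> (nat \<Rightarrow> real) \<Rightarrow> real mat" where
  "hbvm_mat P k s t =
     I_mat P k s t * D_mat s * transpose_mat (P_mat P k s t) * Omega_mat k t"

text \<open>
  The method is implicit, so its map is represented by its graph, the set of pairs
  (old value, new value) for which the stage system has a solution; no solvability or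
  uniqueness is presupposed.  The vector field is only looked at on the phase space
  \<open>U\<close>, in which the stages and both values are required to lie.  With \<open>U = UNIV\<close>
  all solutions of the stage system are admitted; taking for \<open>U\<close> a region in which the
  stage system is uniquely solvable for small \<open>h\<close> gives the graph of the usual
  locally defined function.
\<close>

definition rk_map ::
    "nat \<Rightarrow> real mat \<Rightarrow> (nat \<Rightarrow> real) \<Rightarrow> 'a::euclidean_space set \<Rightarrow> ('a \<Rightarrow> 'a)
       \<Rightarrow> real \<Rightarrow> ('a \<times> 'a) set" where
  "rk_map k C b U f h =
     {(y0, y1). y0 \<in> U \<and> y1 \<in> U \<and>
        (\<exists>Y :: nat \<Rightarrow> 'a.
           (\<forall>i\<le>k. Y i \<in> U \<and> Y i = y0 + h *\<^sub>R (\<Sum>j=0..k. C $$ (i, j) *\<^sub>R f (Y j))) \<and>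
           y1 = y0 + h *\<^sub>R (\<Sum>j=0..k. b j *\<^sub>R f (Y j)))}"

definition adjoint_method :: "(real \<Rightarrow> ('a \<times> 'a) set) \<Rightarrow> real \<Rightarrow> ('a \<times> 'a) set" where
  "adjoint_method \<Phi> h = converse (\<Phi> (- h))"

definition self_adjoint :: "(real \<Rightarrow> ('a \<times> 'a) set) \<Rightarrow> bool" where
  "self_adjoint \<Phi> \<longleftrightarrow> (\<forall>h. \<Phi> h = adjoint_method \<Phi> h)"

text \<open>
  For stepsizes at which the method is given by functions, self-adjointness says
  that the map at \<open>h\<close> is the inverse of the map at \<open>- h\<close>; the second
  fact is the version for partially defined maps.
\<close>

lemma self_adjoint_maps:
  assumes "self_adjoint \<Phi>"
    and "\<Phi> h = {(x, y). y = \<phi> x}" and "\<Phi> (- h) = {(x, y). y = \<psi> x}"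
  shows "\<phi> \<circ> \<psi> = id" and "\<psi> \<circ> \<phi> = id"
proof -
  have eq: "y = \<phi> x \<longleftrightarrow> x = \<psi> y" for x y
  proof -
    have "(x, y) \<in> \<Phi> h \<longleftrightarrow> (y, x) \<in> \<Phi> (- h)"
      using assms(1) unfolding self_adjoint_def adjoint_method_def by blast
    then show ?thesis using assms(2,3) by simp
  qed
  show "\<phi> \<circ> \<psi> = id" using eq by (metis comp_apply eq_id_iff)
  show "\<psi> \<circ> \<phi> = id" using eq by (metis comp_apply eq_id_iff)
qed

lemma self_adjoint_local_maps:
  assumes "self_adjoint \<Phi>" and "(x, y) \<in> \<Phi> h" and "single_valued (\<Phi> (- h))"
  shows "(THE z. (y, z) \<in> \<Phi> (- h)) = x"
proof -
  have "(y, x) \<in> \<Phi> (- h)"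
    using assms(1,2) unfolding self_adjoint_def adjoint_method_def by blast
  then show ?thesis
    using assms(3) by (blast dest: single_valuedD)
qed

end

theory Submission
  imports Defs
begin

text \<open>
  The reflection \<open>x \<mapsto> 1 - x\<close> multiplies \<open>P\<^sub>l\<close> by \<open>(-1)\<^sup>l\<close>, and all \<open>P\<^sub>l\<close> with \<open>l > 0\<close> have mean
  zero on \<open>[0,1]\<close>.  Hence the symmetry of the abscissae gives \<open>b\<^sub>k\<^sub>-\<^sub>j = b\<^sub>j\<close> and
  \<open>C\<^sub>k\<^sub>-\<^sub>i\<^sub>,\<^sub>k\<^sub>-\<^sub>j + C\<^sub>i\<^sub>j = b\<^sub>j\<close>.  These are the classical symmetry conditions for a Runge-Kutta
  method: reversing the order of the stages turns a step with stepsize \<open>h\<close> into a step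
  with stepsize \<open>- h\<close> in the opposite direction.
\<close>

section \<open>Reflection of integrals and definiteness of the inner product\<close>

lemma has_integral_reflect_about:
  fixes f :: "real \<Rightarrow> real"
  shows "((\<lambda>x. f (c - x)) has_integral i) {a..b} \<longleftrightarrow> (f has_integral i) {c - b..c - a}"
proof -
  have *: "((\<lambda>x. g (c - x)) has_integral i) {u..v}"
    if "(g has_integral i) {c - v..c - u}" for g :: "real \<Rightarrow> real" and u v
    using has_integral_affinity[of g i "c - v" "c - u" "-1" c] that
    by (simp add: image_diff_atLeastAtMost)
  show ?thesis
    using *[of f b a] *[of "\<lambda>x. f (c - x)" "c - a" "c - b"] by auto
qed

text \<open>The equivalence holds for every value \<open>i\<close>, so both sides are integrable or
  neither is; hence no integrability assumption is needed here.\<close>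

lemma integral_reflect_about:
  fixes f :: "real \<Rightarrow> real"
  shows "integral {a..b} (\<lambda>x. f (c - x)) = integral {c - b..c - a} f"
  unfolding integral_def integrable_on_def by (simp add: has_integral_reflect_about)

lemma poly_integrable [simp]: "poly p integrable_on {a..b}" for p :: "real poly"
  by (intro integrable_continuous_real continuous_intros)

lemma poly_mult_integrable [simp]:
  "(\<lambda>x. poly p x * poly q x) integrable_on {a..b}" for p q :: "real poly"
  by (intro integrable_continuous_real continuous_intros)

text \<open>A continuous nonnegative function with zero integral vanishes on the interval, and a
  nonzero polynomial has only finitely many roots.\<close>

lemma poly_eq_0_if_integral_square_eq_0:
  fixes p :: "real poly"
  assumes "integral {0..1} (\<lambda>x. poly p x * poly p x) = 0"
  shows "p = 0"
proof (rule ccontr)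
  assume "p \<noteq> 0"
  have "continuous_on {0..1} (\<lambda>x. poly p x * poly p x)"
    by (intro continuous_intros)
  then have "\<forall>x\<in>{0..1}. poly p x * poly p x = 0"
    using assms integral_eq_0_iff[of 0 1 "\<lambda>x. poly p x * poly p x"] by simp
  then have "{0..1} \<subseteq> {x. poly p x = 0}" by auto
  with poly_roots_finite[OF \<open>p \<noteq> 0\<close>] have "finite {0..1::real}"
    by (rule finite_subset[rotated])
  then show False by (simp add: infinite_Icc)
qed

section \<open>Orthogonality and parity of the shifted Legendre polynomials\<close>

lemma shifted_legendre_degree: "shifted_legendre P \<Longrightarrow> degree (P n) = n"
  and shifted_legendre_integral:
    "shifted_legendre P \<Longrightarrow> integral {0..1} (\<lambda>x. poly (P n) x * poly (P l) x)
       = (if n = l then 1 / (2 * real n + 1) else 0)"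
  and shifted_legendre_at_1: "shifted_legendre P \<Longrightarrow> poly (P n) 1 = 1"
  by (simp_all add: shifted_legendre_def)

lemma shifted_legendre_lead_coeff_nz:
  assumes "shifted_legendre P"
  shows "coeff (P n) n \<noteq> 0"
proof -
  have "P n \<noteq> 0" using shifted_legendre_at_1[OF assms, of n] by auto
  then show ?thesis using shifted_legendre_degree[OF assms] leading_coeff_0_iff by metis
qed

lemma shifted_legendre_0:
  assumes "shifted_legendre P"
  shows "P 0 = 1"
proof -
  obtain a where "P 0 = [:a:]"
    using shifted_legendre_degree[OF assms] by (meson degree_eq_zeroE)
  then show ?thesis using shifted_legendre_at_1[OF assms, of 0] by (simp add: one_pCons)
qed

text \<open>Strong induction on the degree: with \<open>m = degree p < n\<close>, subtracting a
  multiple of \<open>P m\<close>, itself orthogonal to \<open>P n\<close>, cancels the leading term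
  of \<open>p\<close>.\<close>

lemma shifted_legendre_orthogonal:
  assumes P: "shifted_legendre P" and "degree p < n"
  shows "integral {0..1} (\<lambda>x. poly p x * poly (P n) x) = 0"
  using \<open>degree p < n\<close>
proof (induction "degree p" arbitrary: p rule: less_induct)
  case less
  define m where "m = degree p"
  define c where "c = coeff p m / coeff (P m) m"
  define q where "q = p - Polynomial.smult c (P m)"
  have "coeff q m = 0"
    using shifted_legendre_lead_coeff_nz[OF P, of m] by (simp add: q_def c_def)
  moreover have "degree q \<le> m"
    unfolding q_def using shifted_legendre_degree[OF P, of m]
    by (intro degree_diff_le) (auto simp: m_def intro: order_trans[OF degree_smult_le])
  \<comment> \<open>The alternative \<open>q = 0\<close> covers constant \<open>p\<close>, where the
    degree cannot drop.\<close>
  ultimately have "q = 0 \<or> degree q < m"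
    by (intro eq_zero_or_degree_less)
  then have q0: "integral {0..1} (\<lambda>x. poly q x * poly (P n) x) = 0"
    using less m_def by auto
  have "(\<lambda>x. poly p x * poly (P n) x)
      = (\<lambda>x. poly q x * poly (P n) x + c * (poly (P m) x * poly (P n) x))"
    by (auto simp: q_def algebra_simps)
  then show ?case
    using q0 less.prems shifted_legendre_integral[OF P, of m n]
    by (simp add: integral_add integrable_on_mult_right m_def)
qed

text \<open>The reflected polynomial \<open>Q\<close> and \<open>(-1) ^ n\<close> times
  \<open>P n\<close> have the same leading coefficient, so their difference \<open>R\<close> has
  degree below \<open>n\<close> or is zero. It is orthogonal to both, hence to itself.\<close>

lemma shifted_legendre_reflect:
  assumes P: "shifted_legendre P"
  shows "poly (P n) (1 - x) = (-1) ^ n * poly (P n) x"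
proof -
  define Q where "Q = pcompose (P n) [:1, -1:]"
  define R where "R = Q - Polynomial.smult ((-1) ^ n) (P n)"
  have Q: "poly Q x = poly (P n) (1 - x)" for x
    by (simp add: Q_def poly_pcompose)
  have dQ: "degree Q = n"
    using shifted_legendre_degree[OF P] by (simp add: Q_def degree_pcompose)
  have "coeff Q n = coeff (P n) n * (-1) ^ n"
    using lead_coeff_comp[of "[:1, -1:]" "P n"] dQ shifted_legendre_degree[OF P, of n]
    by (simp add: Q_def)
  then have "coeff R n = 0" by (simp add: R_def)
  moreover have "degree R \<le> n"
    unfolding R_def using shifted_legendre_degree[OF P, of n] dQ
    by (intro degree_diff_le) (auto intro: order_trans[OF degree_smult_le])
  ultimately have R: "R = 0 \<or> degree R < n"
    by (intro eq_zero_or_degree_less)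
  have "R = 0"
  proof (rule ccontr)
    assume "R \<noteq> 0"
    with R have dR: "degree R < n" by simp
    have RP: "integral {0..1} (\<lambda>x. poly R x * poly (P n) x) = 0"
      by (rule shifted_legendre_orthogonal[OF P dR])
    \<comment> \<open>The substitution moves the reflection from \<open>Q\<close> to
      \<open>R\<close>; the reflected \<open>R\<close> still has degree below
      \<open>n\<close>.\<close>
    have "integral {0..1} (\<lambda>x. poly R x * poly Q x)
        = integral {0..1} (\<lambda>x. poly (pcompose R [:1, -1:]) x * poly (P n) x)"
      using integral_reflect_about[of 0 1 "\<lambda>x. poly R x * poly Q x" 1]
      by (simp add: Q poly_pcompose)
    also have "\<dots> = 0"
      using dR by (intro shifted_legendre_orthogonal[OF P]) (simp add: degree_pcompose)
    finally have RQ: "integral {0..1} (\<lambda>x. poly R x * poly Q x) = 0" .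
    have "(\<lambda>x. poly R x * poly R x)
        = (\<lambda>x. poly R x * poly Q x - (-1) ^ n * (poly R x * poly (P n) x))"
      by (subst (2) R_def) (auto simp: algebra_simps)
    then have "integral {0..1} (\<lambda>x. poly R x * poly R x) = 0"
      using RQ RP by (simp add: integral_diff integrable_on_mult_right)
    with \<open>R \<noteq> 0\<close> show False using poly_eq_0_if_integral_square_eq_0 by blast
  qed
  then have "poly Q x = (-1) ^ n * poly (P n) x" by (simp add: R_def)
  then show ?thesis by (simp add: Q)
qed

text \<open>Parity turns the left side into the integral over \<open>{a..1}\<close>, which
  complements the one over \<open>{0..a}\<close>. The total is the inner product with
  \<open>P 0 = 1\<close>.\<close>

lemma integral_shifted_legendre_reflect:
  assumes P: "shifted_legendre P" and "0 \<le> a" "a \<le> 1"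
  shows "(-1) ^ n * integral {0..1 - a} (poly (P n))
      = (if n = 0 then 1 else 0) - integral {0..a} (poly (P n))"
proof -
  have "integral {0..1 - a} (poly (P n)) = integral {a..1} (\<lambda>x. poly (P n) (1 - x))"
    by (simp add: integral_reflect_about)
  also have "\<dots> = (-1) ^ n * integral {a..1} (poly (P n))"
    by (simp add: shifted_legendre_reflect[OF P])
  finally have "(-1) ^ n * integral {0..1 - a} (poly (P n)) = integral {a..1} (poly (P n))"
    by (simp flip: mult.assoc power_mult_distrib)
  moreover have "integral {0..a} (poly (P n)) + integral {a..1} (poly (P n))
      = integral {0..1} (poly (P n))"
    using assms by (intro Henstock_Kurzweil_Integration.integral_combine) auto
  moreover have "integral {0..1} (poly (P n)) = (if n = 0 then 1 else 0)"
    using shifted_legendre_integral[OF P, of n 0] by (simp add: shifted_legendre_0[OF P])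
  ultimately show ?thesis by simp
qed

section \<open>Symmetry of the weights and the coefficient matrix\<close>

text \<open>The Lagrange basis polynomial of node \<open>k - i\<close> at \<open>1 - x\<close>
  equals that of node \<open>i\<close> at \<open>x\<close>.\<close>

lemma interp_weight_reflect:
  assumes sym: "\<forall>i\<le>k. t (k - i) = 1 - t i" and "i \<le> k"
  shows "interp_weight k t (k - i) = interp_weight k t i"
proof -
  have "(\<Prod>j\<in>{0..k} - {k - i}. (1 - x - t j) / (t (k - i) - t j))
      = (\<Prod>j\<in>{0..k} - {i}. (x - t j) / (t i - t j))" for x
  proof (rule prod.reindex_bij_witness[of _ "\<lambda>j. k - j" "\<lambda>j. k - j"], goal_cases)
    \<comment> \<open>Equality of matching factors: numerator and denominator both change
      sign.\<close>
    case (5 j)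
    then have "j \<le> k" by simp
    then have "t (k - j) = 1 - t j" "t (k - i) = 1 - t i" using sym \<open>i \<le> k\<close> by blast+
    moreover have "(x - (1 - t j)) / (t i - (1 - t j))
        = (1 - x - t j) / (1 - t i - t j)"
      using minus_divide_divide[of "1 - x - t j" "1 - t i - t j"] by (simp add: algebra_simps)
    ultimately show ?case by simp
  qed (use \<open>i \<le> k\<close> in auto)
  then show ?thesis
    unfolding interp_weight_def
    using integral_reflect_about
      [of 0 1 "\<lambda>x. \<Prod>j\<in>{0..k} - {k - i}. (x - t j) / (t (k - i) - t j)" 1]
    by simp
qed

text \<open>Both diagonal matrices multiply from the right and only scale columns.\<close>

lemma hbvm_mat_entry:
  assumes "i \<le> k" "j \<le> k"
  shows "hbvm_mat P k s t $$ (i, j)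
    = interp_weight k t j *
      (\<Sum>l<s. (2 * real l + 1) * poly (P l) (t j) * integral {0..t i} (poly (P l)))"
proof -
  have "I_mat P k s t \<in> carrier_mat (k + 1) s" by (simp add: I_mat_def)
  then have "I_mat P k s t * D_mat s
      = Matrix.mat (k + 1) s (\<lambda>(i, l). integral {0..t i} (poly (P l)) * (2 * real l + 1))"
    unfolding D_mat_def by (subst mat_diag_mult_right) (auto simp: I_mat_def)
  moreover have "I_mat P k s t * D_mat s * transpose_mat (P_mat P k s t)
      \<in> carrier_mat (k + 1) (k + 1)"
    by (auto simp: I_mat_def D_mat_def P_mat_def mat_diag_def)
  ultimately show ?thesis
    unfolding hbvm_mat_def Omega_mat_def using assms
    by (subst mat_diag_mult_right)
      (auto simp: P_mat_def scalar_prod_def lessThan_atLeast0 mult_ac)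
qed

text \<open>The sign \<open>(-1) ^ l\<close> from reflecting \<open>t j\<close> is absorbed by the
  reflected integral, which leaves the mean of \<open>P l\<close> minus the original
  integral.\<close>

lemma hbvm_mat_reflect:
  assumes P: "shifted_legendre P" and "1 \<le> s"
    and sym: "\<forall>i\<le>k. t (k - i) = 1 - t i" and t01: "\<forall>i\<le>k. t i \<in> {0..1}"
    and "i \<le> k" "j \<le> k"
  shows "hbvm_mat P k s t $$ (k - i, k - j) = interp_weight k t j - hbvm_mat P k s t $$ (i, j)"
proof -
  let ?w = "\<lambda>l. (2 * real l + 1) * poly (P l) (t j)"
  have "(\<Sum>l<s. (2 * real l + 1) * poly (P l) (t (k - j)) * integral {0..t (k - i)} (poly (P l)))
      = (\<Sum>l<s. ?w l * ((-1) ^ l * integral {0..1 - t i} (poly (P l))))"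
    using sym assms(5,6) by (simp add: shifted_legendre_reflect[OF P] mult_ac)
  also have "\<dots> = (\<Sum>l<s. (if l = 0 then 1 else 0) - ?w l * integral {0..t i} (poly (P l)))"
    using t01 \<open>i \<le> k\<close>
    by (intro sum.cong)
      (auto simp: integral_shifted_legendre_reflect[OF P] shifted_legendre_0[OF P] algebra_simps)
  \<comment> \<open>Only \<open>l = 0\<close> contributes a mean, and it lies in the range because
    \<open>1 \<le> s\<close>.\<close>
  also have "\<dots> = 1 - (\<Sum>l<s. ?w l * integral {0..t i} (poly (P l)))"
    using \<open>1 \<le> s\<close> by (simp add: sum_subtractf)
  finally show ?thesis
    using sym \<open>i \<le> k\<close> \<open>j \<le> k\<close>
    by (simp add: hbvm_mat_entry interp_weight_reflect right_diff_distrib)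
qed

section \<open>Self-adjointness from the symmetry conditions\<close>

lemma rk_map_self_adjoint:
  assumes b: "\<And>j. j \<le> k \<Longrightarrow> b (k - j) = b j"
    and C: "\<And>i j. i \<le> k \<Longrightarrow> j \<le> k \<Longrightarrow> C $$ (k - i, k - j) = b j - C $$ (i, j)"
  shows "self_adjoint (rk_map k C b U f)"
proof -
  \<comment> \<open>One implication for all \<open>h\<close> suffices: the converse is the instance
    \<open>- h\<close>.\<close>
  have rev: "(y1, y0) \<in> rk_map k C b U f (- h)" if step: "(y0, y1) \<in> rk_map k C b U f h"
    for y0 y1 h
  proof -
    obtain Y where Y: "\<And>i. i \<le> k \<Longrightarrow> Y i \<in> U"
        "\<And>i. i \<le> k \<Longrightarrow> Y i = y0 + h *\<^sub>R (\<Sum>j=0..k. C $$ (i, j) *\<^sub>R f (Y j))"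
      and y1: "y1 = y0 + h *\<^sub>R (\<Sum>j=0..k. b j *\<^sub>R f (Y j))"
      and U: "y0 \<in> U" "y1 \<in> U"
      using step unfolding rk_map_def by blast
    have stage: "Y (k - i) = y1 + (- h) *\<^sub>R (\<Sum>j=0..k. C $$ (i, j) *\<^sub>R f (Y (k - j)))"
      if "i \<le> k" for i
    proof -
      have "(\<Sum>j=0..k. C $$ (k - i, j) *\<^sub>R f (Y j))
          = (\<Sum>j=0..k. C $$ (k - i, k - j) *\<^sub>R f (Y (k - j)))"
        using sum.atLeastAtMost_rev[of _ 0 k] by simp
      also have "\<dots> = (\<Sum>j=0..k. b j *\<^sub>R f (Y (k - j)))
          - (\<Sum>j=0..k. C $$ (i, j) *\<^sub>R f (Y (k - j)))"
        using that by (simp add: C scaleR_left_diff_distrib flip: sum_subtractf)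
      \<comment> \<open>This sum times \<open>h\<close> is the full increment
        \<open>y1 - y0\<close>, so the stage equation can be based at \<open>y1\<close> instead of
        \<open>y0\<close>.\<close>
      also have "(\<Sum>j=0..k. b j *\<^sub>R f (Y (k - j))) = (\<Sum>j=0..k. b j *\<^sub>R f (Y j))"
        using sum.atLeastAtMost_rev[of "\<lambda>j. b j *\<^sub>R f (Y j)" 0 k] by (simp add: b)
      finally show ?thesis
        using Y(2)[of "k - i"] y1 by (simp add: scaleR_right_diff_distrib)
    qed
    have "(\<Sum>j=0..k. b j *\<^sub>R f (Y (k - j))) = (\<Sum>j=0..k. b j *\<^sub>R f (Y j))"
      using sum.atLeastAtMost_rev[of "\<lambda>j. b j *\<^sub>R f (Y j)" 0 k] by (simp add: b)
    with y1 have y0: "y0 = y1 + (- h) *\<^sub>R (\<Sum>j=0..k. b j *\<^sub>R f (Y (k - j)))" by simp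
    have "\<forall>i\<le>k. Y (k - i) \<in> U \<and>
        Y (k - i) = y1 + (- h) *\<^sub>R (\<Sum>j=0..k. C $$ (i, j) *\<^sub>R f (Y (k - j)))"
      using Y(1) stage diff_le_self by blast
    with U y0 show ?thesis
      unfolding rk_map_def mem_Collect_eq prod.case by (intro conjI exI[of _ "\<lambda>i. Y (k - i)"])
  qed
  show ?thesis
    unfolding self_adjoint_def adjoint_method_def
  proof (intro allI Set.set_eqI iffI)
    fix h p assume "p \<in> rk_map k C b U f h"
    then show "p \<in> (rk_map k C b U f (- h))\<inverse>"
      using rev[of "fst p" "snd p" h] by (cases p) simp
  next
    fix h p assume "p \<in> (rk_map k C b U f (- h))\<inverse>"
    then show "p \<in> rk_map k C b U f h"
      using rev[of "snd p" "fst p" "- h"] by (cases p) simp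
  qed
qed

theorem theorem3:
  fixes k s :: nat and t :: "nat \<Rightarrow> real" and P :: "nat \<Rightarrow> real poly"
    and U :: "'a::euclidean_space set" and f :: "'a \<Rightarrow> 'a"
  assumes "1 \<le> s" and "s \<le> k"
    and "t 0 = 0" and "t k = 1" and "\<forall>i<k. t i < t (Suc i)"
    and "\<forall>i\<le>k. t (k - i) = 1 - t i"
    and "shifted_legendre P"
  shows "self_adjoint (rk_map k (hbvm_mat P k s t) (interp_weight k t) U f)"
proof -
  have nonneg: "0 \<le> t i" if "i \<le> k" for i
    using that
  proof (induction i)
    case (Suc i)
    then show ?case using assms(5) by (metis Suc_le_lessD less_imp_le order_trans)
  qed (simp add: assms(3))
  \<comment> \<open>The upper bound is nonnegativity of \<open>t (k - i) = 1 - t i\<close>.\<close>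
  then have "\<forall>i\<le>k. t i \<in> {0..1}"
    using assms(6) by (metis atLeastAtMost_iff diff_ge_0_iff_ge diff_le_self)
  then show ?thesis
    using assms by (intro rk_map_self_adjoint) (simp_all add: interp_weight_reflect hbvm_mat_reflect)
qed

end
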